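(* Let $S$ be a perfectly supportable semigroup. Then $S$ is $\sigma$-discrete in its semi-Zariski topology $\mathfrak Z_s$, and hence $S$ is $\sigma$-discrete in each shift-invariant Hausdorff topology on $S$.
   Context: A $\mathsf{supt}$-semigroup is a pair $(S,\mathsf{supt})$ consisting of a semigroup $S$ and a function $\mathsf{supt}:S\to 2^X$ into the power set of some set $X$ such that for all $f,g\in S$: (1) $\mathsf{supt}(fg)\subset\mathsf{supt}(f)\cup\mathsf{supt}(g)$, and (2) $fg=gf$ whenever $\mathsf{supt}(f)\cap\mathsf{supt}(g)=\emptyset$. The set $\mathsf{supt}(S)=\bigcup_{a\in S}\mathsf{supt}(a)\subset X$ is called the support of $S$. For $F\subset X$ put $S(F)=\{f\in S:\mathsf{supt}(f)\subset F\}$. A $\mathsf{supt}$-semigroup $(S,\mathsf{supt})$ with support $X=\mathsf{supt}(S)$ is $\mathsf{supt}$-finitary if each $f\in S$ has finite support $\mathsf{supt}(f)$ and for each finite $F\subset X$ the set $S(F)$ is finite. It is $\mathsf{supt}$-perfect if it is $\mathsf{supt}$-finitary and $S(F)=\mathsf C(S(X\setminus F))$ for every finite $F\subset X$, where for $T\subset S$ the centralizer is $\mathsf C(T)=\{g\in S: fg=gf \text{ for all } f\in T\}$. A semigroup $S$ is perfectly supportable if for some function $\mathsf{supt}:S\to 2^X$ the pair $(S,\mathsf{supt})$ is a $\mathsf{supt}$-perfect semigroup. The semi-Zariski topology $\mathfrak Z_s$ on a semigroup $S$ is the topology generated by the sub-base consisting of the sets $\{x\in S:axb\ne c\}$ and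 $\{x\in S:axb\ne cxd\}$, where $a,b,c,d\in S^1$ and $S^1=S\cup\{1\}$ is $S$ with an attached external unit $1\notin S$ (so $1x=x1=x$ for all $x\in S^1$). A topology on a semigroup $S$ is shift-invariant if for every $a\in S$ the shifts $x\mapsto ax$ and $x\mapsto xa$ are continuous maps $S\to S$. A topological space is $\sigma$-discrete if it can be written as a countable union of discrete subspaces. *)

theory Defs
  imports "HOL-Analysis.Analysis"
begin

definition supt_semigroup :: "('a::semigroup_mult \<Rightarrow> 'x set) \<Rightarrow> bool" where
  "supt_semigroup supt \<longleftrightarrow>
     (\<forall>f g. supt (f * g) \<subseteq> supt f \<union> supt g) \<and>
     (\<forall>f g. supt f \<inter> supt g = {} \<longrightarrow> f * g = g * f)"

definition total_supt :: "('a \<Rightarrow> 'x set) \<Rightarrow> 'x set" where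
  "total_supt supt = (\<Union>a. supt a)"

definition supported_in :: "('a \<Rightarrow> 'x set) \<Rightarrow> 'x set \<Rightarrow> 'a set" where
  "supported_in supt F = {f. supt f \<subseteq> F}"

definition centralizer :: "'a::semigroup_mult set \<Rightarrow> 'a set" where
  "centralizer T = {g. \<forall>f\<in>T. f * g = g * f}"

definition supt_finitary :: "('a::semigroup_mult \<Rightarrow> 'x set) \<Rightarrow> bool" where
  "supt_finitary supt \<longleftrightarrow>
     supt_semigroup supt \<and>
     (\<forall>f. finite (supt f)) \<and>
     (\<forall>F. finite F \<and> F \<subseteq> total_supt supt \<longrightarrow> finite (supported_in supt F))"

definition supt_perfect :: "('a::semigroup_mult \<Rightarrow> 'x set) \<Rightarrow> bool" where
  "supt_perfect supt \<longleftrightarrow>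
     supt_finitary supt \<and>
     (\<forall>F. finite F \<and> F \<subseteq> total_supt supt \<longrightarrow>
        supported_in supt F = centralizer (supported_in supt (total_supt supt - F)))"

text \<open>
  HOL cannot quantify existentially over the type of the points making up the supports, so this
  type is a parameter. As a hypothesis of a theorem with \<open>'x\<close> free, the predicate means that
  a supporting function exists for some \<open>'x\<close>.
\<close>

definition perfectly_supportable :: "'a::semigroup_mult itself \<Rightarrow> 'x itself \<Rightarrow> bool" where
  "perfectly_supportable _ _ \<longleftrightarrow> (\<exists>supt :: 'a \<Rightarrow> 'x set. supt_perfect supt)"

text \<open>
  The semigroup with an external unit attached. \<open>Ext_Unit\<close> is new even if the semigroup
  already has a unit.
\<close>

datatype 'a adjoin_unit = Ext_Unit | Elem 'a

instantiation adjoin_unit :: (semigroup_mult) monoid_mult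
begin

definition one_adjoin_unit :: "'a adjoin_unit" where
  "1 = Ext_Unit"

fun times_adjoin_unit :: "'a adjoin_unit \<Rightarrow> 'a adjoin_unit \<Rightarrow> 'a adjoin_unit" where
  "Ext_Unit * y = y"
| "Elem a * Ext_Unit = Elem a"
| "Elem a * Elem b = Elem (a * b)"

instance
proof
  fix a b c :: "'a adjoin_unit"
  show "a * b * c = a * (b * c)"
    by (cases a; cases b; cases c) (simp_all add: mult.assoc)
  show "1 * a = a"
    by (simp add: one_adjoin_unit_def)
  show "a * 1 = a"
    by (cases a) (simp_all add: one_adjoin_unit_def)
qed

end

text \<open>
  The sub-base covers the whole type, since \<open>a * Elem x * b\<close> never equals \<open>1\<close>; hence this is a
  topology on all of the semigroup.
\<close>

definition semi_zariski :: "'a::semigroup_mult topology" where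
  "semi_zariski = topology_generated_by
     ({{x. a * Elem x * b \<noteq> c} | a b c. True} \<union>
      {{x. a * Elem x * b \<noteq> c * Elem x * d} | a b c d. True})"

definition shift_invariant :: "'a::semigroup_mult topology \<Rightarrow> bool" where
  "shift_invariant T \<longleftrightarrow>
     (\<forall>a. continuous_map T T (\<lambda>x. a * x) \<and> continuous_map T T (\<lambda>x. x * a))"

definition sigma_discrete :: "'a topology \<Rightarrow> bool" where
  "sigma_discrete T \<longleftrightarrow>
     (\<exists>\<D>. countable \<D> \<and> \<Union>\<D> = topspace T \<and>
        (\<forall>D\<in>\<D>. subtopology T D = discrete_topology D))"

lemma topspace_semi_zariski: "topspace (semi_zariski :: 'a::semigroup_mult topology) = UNIV"
proof -
  have "x \<in> topspace semi_zariski" for x :: 'a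
  proof -
    have "x \<in> {y. 1 * Elem y * 1 \<noteq> 1}"
      by (simp add: one_adjoin_unit_def)
    moreover have "{y :: 'a. 1 * Elem y * 1 \<noteq> 1} \<in> {{x. a * Elem x * b \<noteq> c} | a b c. True}"
      by (rule CollectI, intro exI conjI TrueI, rule refl)
    ultimately show ?thesis
      unfolding semi_zariski_def topology_generated_by_topspace by (intro UnionI UnI1)
  qed
  then show ?thesis
    by auto
qed

end

theory Submission
  imports Defs
begin

text \<open>
  The pieces are the sets of elements whose supports have a given cardinality \<open>n\<close>. If \<open>x\<close> belongs
  to \<open>supt f\<close> and \<open>K\<close> is finite, perfectness provides some \<open>g\<close> that does not commute with \<open>f\<close> and
  whose support avoids \<open>K\<close> except possibly at \<open>x\<close>. Choosing \<open>n + 1\<close> such elements one after the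
  other, with supports pairwise disjoint outside \<open>x\<close>, every \<open>h\<close> with at most \<open>n\<close> points in its
  support that commutes with none of them has \<open>x\<close> in its support. So near \<open>f\<close> all elements of
  the piece have support \<open>supt f\<close>, and there are only finitely many of those.
\<close>

lemma supt_perfect_finite_supt: "supt_perfect supt \<Longrightarrow> finite (supt f)"
  by (simp add: supt_perfect_def supt_finitary_def)

lemma supt_perfect_finite_supported_in:
  assumes "supt_perfect supt"
  shows "finite (supported_in supt (supt f))"
proof -
  have fin: "supt_finitary supt"
    using assms by (simp add: supt_perfect_def)
  moreover have "supt f \<subseteq> total_supt supt"
    by (auto simp: total_supt_def)
  ultimately show ?thesis
    by (simp add: supt_finitary_def)
qed

lemma supt_perfect_commute:
  assumes "supt_perfect supt" "supt f \<inter> supt g = {}"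
  shows "f * g = g * f"
proof -
  have "supt_semigroup supt"
    using assms(1) by (simp add: supt_perfect_def supt_finitary_def)
  with assms(2) show ?thesis
    unfolding supt_semigroup_def by blast
qed

text \<open>Since \<open>x\<close> is in \<open>supt f\<close> but not in \<open>F\<close>,
  perfectness keeps \<open>f\<close> out of the centralizer of the elements supported off
  \<open>F\<close>.\<close>

lemma supt_perfect_noncommuting:
  assumes "supt_perfect supt" and x: "x \<in> supt f" and K: "finite K"
  obtains g where "g * f \<noteq> f * g" "supt g \<inter> K \<subseteq> {x}"
proof -
  \<comment> \<open>Perfectness speaks only of finite subsets of \<open>total_supt supt\<close>,
    hence the intersection.\<close>
  define F where "F = K \<inter> total_supt supt - {x}"
  have "finite F" "F \<subseteq> total_supt supt"
    using K by (auto simp: F_def)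
  then have "supported_in supt F = centralizer (supported_in supt (total_supt supt - F))"
    using assms(1) unfolding supt_perfect_def by blast
  moreover have "f \<notin> supported_in supt F"
    using x by (auto simp: supported_in_def F_def)
  ultimately obtain g where "g * f \<noteq> f * g" "supt g \<subseteq> total_supt supt - F"
    unfolding centralizer_def supported_in_def by blast
  then show thesis
    using that by (auto simp: F_def)
qed

text \<open>Common ground of the semi-Zariski topology and the shift-invariant Hausdorff ones, so
  that one argument serves both.\<close>

locale noncommuting_open =
  fixes T :: "'a::semigroup_mult topology"
  assumes topspace [simp]: "topspace T = UNIV"
    and openin_noncommuting: "\<And>g. openin T {x. g * x \<noteq> x * g}"
begin

text \<open>Induction on \<open>n\<close> with \<open>K\<close> arbitrary: \<open>K\<close> holds
  the supports already used, so that no point of \<open>supt h\<close> is counted twice.\<close>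

lemma openin_supt_mem_or_large:
  fixes supt :: "'a \<Rightarrow> 'x set"
  assumes perf: "supt_perfect supt" and x: "x \<in> supt f" and "finite K"
  shows "\<exists>U. openin T U \<and> f \<in> U \<and> (\<forall>h\<in>U. x \<notin> supt h \<longrightarrow> n \<le> card (supt h - K))"
  using \<open>finite K\<close>
proof (induction n arbitrary: K)
  case 0
  show ?case
    using openin_topspace[of T] by auto
next
  case (Suc n)
  note fin = supt_perfect_finite_supt[OF perf]
  obtain g where g: "g * f \<noteq> f * g" "supt g \<inter> K \<subseteq> {x}"
    using supt_perfect_noncommuting[OF perf x Suc.prems] .
  obtain U where U: "openin T U" "f \<in> U"
    "\<forall>h\<in>U. x \<notin> supt h \<longrightarrow> n \<le> card (supt h - (K \<union> supt g))"
    using Suc.IH[of "K \<union> supt g"] Suc.prems fin by auto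
  have "Suc n \<le> card (supt h - K)" if h: "h \<in> U" "g * h \<noteq> h * g" "x \<notin> supt h" for h
  proof -
    \<comment> \<open>As \<open>x\<close> is not in \<open>supt h\<close>, \<open>y\<close> differs
      from \<open>x\<close> and so avoids \<open>K\<close>: it is a new point beyond the
      \<open>n\<close> counted outside \<open>K \<union> supt g\<close>.\<close>
    obtain y where "y \<in> supt g" "y \<in> supt h"
      using supt_perfect_commute[OF perf, of g h] h(2) by blast
    then have "supt h - (K \<union> supt g) \<subset> supt h - K"
      using g(2) h(3) by blast
    then have "card (supt h - (K \<union> supt g)) < card (supt h - K)"
      by (simp add: fin psubset_card_mono)
    with U(3) h show ?thesis
      by force
  qed
  then show ?case
    using U g(1) openin_noncommuting[of g]
    by (intro exI[of _ "U \<inter> {y. g * y \<noteq> y * g}"]) auto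
qed

lemma sigma_discrete_if_supt_perfect:
  fixes supt :: "'a \<Rightarrow> 'x set"
  assumes perf: "supt_perfect supt" and t1: "t1_space T"
  shows "sigma_discrete T"
proof -
  define D where "D n = {f. card (supt f) = n}" for n
  note fin = supt_perfect_finite_supt[OF perf]
  have "openin (subtopology T (D n)) {f}" if f: "f \<in> D n" for n f
  proof -
    \<comment> \<open>\<open>Suc n\<close> exceeds the size of every support in \<open>D n\<close>,
      so members of \<open>D n\<close> in this neighbourhood must have \<open>x\<close> in their
      support.\<close>
    have "\<forall>x\<in>supt f. \<exists>U. openin T U \<and> f \<in> U \<and>
        (\<forall>h\<in>U. x \<notin> supt h \<longrightarrow> Suc n \<le> card (supt h - {}))"
      using openin_supt_mem_or_large[OF perf] by blast
    then obtain U where U: "\<And>x. x \<in> supt f \<Longrightarrow> openin T (U x) \<and> f \<in> U x \<and>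
        (\<forall>h\<in>U x. x \<notin> supt h \<longrightarrow> Suc n \<le> card (supt h))"
      by (metis Diff_empty)
    define V where "V = (\<Inter>x\<in>supt f. U x)"
    define R where "R = supported_in supt (supt f) - {f}"
    have "openin T V"
    proof (cases "supt f = {}")
      \<comment> \<open>The empty intersection is \<open>UNIV\<close>, the whole space.\<close>
      case True
      then show ?thesis
        using openin_topspace[of T] by (simp add: V_def)
    next
      case False
      then show ?thesis
        using U fin by (auto simp: V_def)
    qed
    moreover have "finite R"
      using supt_perfect_finite_supported_in[OF perf] by (simp add: R_def)
    then have "closedin T R"
      using t1 by (simp add: t1_space_closedin_finite)
    ultimately have "openin T (V - R)"
      by (rule openin_diff)
    moreover have "(V - R) \<inter> D n = {f}"
    proof -
      have "h = f" if h: "h \<in> V" "h \<notin> R" "h \<in> D n" for h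
      proof -
        \<comment> \<open>Both supports have \<open>n\<close> points, so inclusion will force
          equality.\<close>
        have "supt f \<subseteq> supt h"
          using U h by (fastforce simp: V_def D_def)
        then have "supt f = supt h"
          using f h(3) fin by (simp add: D_def card_subset_eq)
        then show ?thesis
          using h(2) by (simp add: R_def supported_in_def)
      qed
      moreover have "f \<in> V" "f \<notin> R"
        using U by (auto simp: V_def R_def)
      ultimately show ?thesis
        using f by blast
    qed
    ultimately show ?thesis
      unfolding openin_subtopology by (intro exI[of _ "V - R"]) simp
  qed
  then have "subtopology T (D n) = discrete_topology (D n)" for n
    by (subst eq_commute) (simp add: discrete_topology_unique)
  moreover have "\<Union>(range D) = topspace T"
    by (auto simp: D_def)
  ultimately show ?thesis
    unfolding sigma_discrete_def by (intro exI[of _ "range D"]) auto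
qed

end

lemma openin_semi_zariski_neq_const: "openin semi_zariski {x. a * Elem x * b \<noteq> c}"
  unfolding semi_zariski_def by (rule topology_generated_by_Basis) blast

lemma openin_semi_zariski_neq: "openin semi_zariski {x. a * Elem x * b \<noteq> c * Elem x * d}"
  unfolding semi_zariski_def by (rule topology_generated_by_Basis) blast

lemma t1_space_semi_zariski: "t1_space semi_zariski"
proof -
  have "openin semi_zariski (- {c})" for c :: 'a
    \<comment> \<open>With units on both sides the sub-basic set is the complement of a
      point.\<close>
    using openin_semi_zariski_neq_const[of 1 1 "Elem c"]
    by (simp add: Compl_eq)
  then show ?thesis
    by (simp add: t1_space_closedin_singleton closedin_def topspace_semi_zariski Compl_eq_Diff_UNIV)
qed

lemma noncommuting_open_semi_zariski: "noncommuting_open semi_zariski"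
proof
  show "openin semi_zariski {x. g * x \<noteq> x * g}" for g :: 'a
    using openin_semi_zariski_neq[of "Elem g" 1 1 "Elem g"] by simp
qed (rule topspace_semi_zariski)

text \<open>Two continuous maps into a Hausdorff space, here the two shifts by \<open>g\<close>,
  agree on a closed set.\<close>

lemma noncommuting_open_if_shift_invariant:
  assumes T: "topspace T = UNIV" "shift_invariant T" "Hausdorff_space T"
  shows "noncommuting_open T"
proof
  fix g
  have "closedin T {x \<in> topspace T. g * x = x * g}"
    using T by (intro closedin_continuous_maps_eq) (auto simp: shift_invariant_def)
  moreover have "UNIV - {x. g * x = x * g} = {x. g * x \<noteq> x * g}"
    by blast
  ultimately show "openin T {x. g * x \<noteq> x * g}"
    by (simp add: T(1) closedin_def)
qed (rule T(1))

theorem corollary3p5: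
  assumes "perfectly_supportable TYPE('a::semigroup_mult) TYPE('x)"
  shows "sigma_discrete (semi_zariski :: 'a topology) \<and>
    (\<forall>T :: 'a topology. topspace T = UNIV \<and> shift_invariant T \<and> Hausdorff_space T \<longrightarrow>
       sigma_discrete T)"
proof -
  obtain supt :: "'a \<Rightarrow> 'x set" where supt: "supt_perfect supt"
    using assms by (auto simp: perfectly_supportable_def)
  show ?thesis
    using noncommuting_open.sigma_discrete_if_supt_perfect[OF _ supt]
      noncommuting_open_semi_zariski t1_space_semi_zariski
      noncommuting_open_if_shift_invariant Hausdorff_imp_t1_space
    by blast
qed

end
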